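(* Let $\mu_1<\mu_2$ be fixed reals, $\alpha\in(0,1)$, let $p=p_N,\ q=q_N\in(0,1]$ satisfy $p>q>0$ and $p,q=\omega(\log N/N)$ as $N\to\infty$, and let $\mathcal{G}=(A,X)\sim\mathrm{CSBM}(N,p,q,\mu_1,\mu_2,\sigma^2)$. Fix $r>0$ and $K\in\mathbb{N}$. There exists a constant $C=C(\alpha,r,K)$ (which may also depend on $\mu_1,\mu_2$, but not on $N$) such that with probability at least $1-O(1/N^r)$, $$\mu_2^{\mathrm{PPNP}}-\mu_1^{\mathrm{PPNP}}=\frac{p+q}{p+\frac{2-\alpha}{\alpha}q}(\mu_2-\mu_1)+\epsilon,$$ where the error term satisfies $|\epsilon|\le C/\sqrt{N(p+q)}+(1-\alpha)^{K+1}$.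
   Context: $\mathrm{CSBM}(N,p,q,\mu_1,\mu_2,\sigma^2)$ (Contextual Stochastic Block Model), $N$ even: the node set $[N]$ is split into two classes $\mathcal{C}_1,\mathcal{C}_2$ of size $N/2$. The symmetric adjacency matrix $A\in\{0,1\}^{N\times N}$ has independent Bernoulli entries $A_{uv}$, $u\le v$, with parameter $p$ if $u,v$ are in the same class and $q$ otherwise. Independently, $X\in\mathbb{R}^N$ has independent entries $X_v\sim\mathcal{N}(\mu_i,\sigma^2)$ for $v\in\mathcal{C}_i$. $D=\mathrm{diag}(A\mathbf{1}_N)$ is the degree matrix (in the stated regime all degrees are positive with high probability; high-probability events are understood to include this). PPNP (personalized propagation of neural predictions) with teleportation probability $\alpha$ outputs $h^{\mathrm{PPNP}}=\alpha\big(I_N-(1-\alpha)D^{-1}A\big)^{-1}X$. Let $\mu\in\mathbb{R}^N$ have $\mu_v=\mu_i$ for $v\in\mathcal{C}_i$. Then $\mu_i^{\mathrm{PPNP}}=\frac{1}{N/2}\sum_{v\in\mathcal{C}_i}\big(\alpha(I_N-(1-\alpha)D^{-1}A)^{-1}\mu\big)_v$ is the class-$i$ average of the conditional means of $h^{\mathrm{PPNP}}$ given $A$. The probability is over the random graph $A$. *)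

theory Defs
  imports "HOL-Probability.Probability" "Jordan_Normal_Form.Determinant"
begin

unbundle no vec_syntax
hide_const (open) Finite_Cartesian_Product.vec Finite_Cartesian_Product.mat

text \<open>
  The node set is \<open>{..<N}\<close>, matching the 0-based indexing of \<^typ>\<open>real mat\<close>.
\<close>

definition balanced_classes :: "nat \<Rightarrow> nat set \<Rightarrow> nat set \<Rightarrow> bool" where
  "balanced_classes N C1 C2 \<longleftrightarrow>
     C1 \<union> C2 = {..<N} \<and> C1 \<inter> C2 = {} \<and> 2 * card C1 = N \<and> 2 * card C2 = N"

definition edge_prob :: "nat set \<Rightarrow> nat set \<Rightarrow> real \<Rightarrow> real \<Rightarrow> nat \<Rightarrow> nat \<Rightarrow> real" where
  "edge_prob C1 C2 p q u v =
     (if u \<in> C1 \<and> v \<in> C1 \<or> u \<in> C2 \<and> v \<in> C2 then p else q)"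

definition class_mean :: "nat set \<Rightarrow> real \<Rightarrow> real \<Rightarrow> nat \<Rightarrow> real" where
  "class_mean C1 mu1 mu2 v = (if v \<in> C1 then mu1 else mu2)"

definition adjacency_matrix :: "nat \<Rightarrow> (nat \<times> nat \<Rightarrow> bool) \<Rightarrow> real mat" where
  "adjacency_matrix N e = Matrix.mat N N (\<lambda>(u, v). of_bool (e (min u v, max u v)))"

text \<open>
  One independent Bernoulli variable per pair \<open>u \<le> v\<close>, so self-loops are allowed;
  \<^const>\<open>Pi_pmf\<close> is the finite product and \<^const>\<open>False\<close> is its value off the index set.
\<close>

definition sbm_pmf :: "nat \<Rightarrow> nat set \<Rightarrow> nat set \<Rightarrow> real \<Rightarrow> real \<Rightarrow> real mat pmf" where
  "sbm_pmf N C1 C2 p q =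
     map_pmf (adjacency_matrix N)
       (Pi_pmf {(u, v). u \<le> v \<and> v < N} False
          (\<lambda>(u, v). bernoulli_pmf (edge_prob C1 C2 p q u v)))"

text \<open>
  The joint law of \<open>(A, X)\<close>. The parameter \<open>\<sigma>\<close> is the standard deviation.
\<close>

definition csbm ::
  "nat \<Rightarrow> nat set \<Rightarrow> nat set \<Rightarrow> real \<Rightarrow> real \<Rightarrow> real \<Rightarrow> real \<Rightarrow> real
    \<Rightarrow> (real mat \<times> (nat \<Rightarrow> real)) measure" where
  "csbm N C1 C2 p q mu1 mu2 \<sigma> =
     measure_pmf (sbm_pmf N C1 C2 p q) \<Otimes>\<^sub>M
     (\<Pi>\<^sub>M v\<in>{..<N}. density lborel (\<lambda>x. ennreal (normal_density (class_mean C1 mu1 mu2 v) \<sigma> x)))"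

definition mat_inv :: "real mat \<Rightarrow> real mat" where
  "mat_inv B = the (mat_inverse B)"

definition degree_vec :: "real mat \<Rightarrow> real vec" where
  "degree_vec A = A *\<^sub>v Matrix.vec (dim_col A) (\<lambda>_. 1)"

definition degree_matrix :: "real mat \<Rightarrow> real mat" where
  "degree_matrix A = mat_diag (dim_row A) (\<lambda>v. degree_vec A $ v)"

definition ppnp :: "real \<Rightarrow> real mat \<Rightarrow> real vec \<Rightarrow> real vec" where
  "ppnp \<alpha> A x =
     \<alpha> \<cdot>\<^sub>v (mat_inv (1\<^sub>m (dim_row A) - (1 - \<alpha>) \<cdot>\<^sub>m (mat_inv (degree_matrix A) * A)) *\<^sub>v x)"

text \<open>
  Since \<^const>\<open>ppnp\<close> is linear in the features, the class average over \<open>C\<close> of the conditional means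
  of its output given \<open>A\<close> is obtained by propagating the mean vector of the features.
  The final argument \<open>C\<close> is the class over which the average is taken.
\<close>

definition mu_ppnp ::
  "real \<Rightarrow> nat \<Rightarrow> nat set \<Rightarrow> real \<Rightarrow> real \<Rightarrow> real mat \<Rightarrow> nat set \<Rightarrow> real" where
  "mu_ppnp \<alpha> N C1 mu1 mu2 A C =
     1 / (real N / 2) * (\<Sum>v\<in>C. ppnp \<alpha> A (Matrix.vec N (class_mean C1 mu1 mu2)) $ v)"

lemma mat_inv_eqI:
  assumes B: "B \<in> carrier_mat n n" and C: "C \<in> carrier_mat n n" and BC: "B * C = 1\<^sub>m n"
  shows "mat_inv B = C"
proof -
  have CB: "C * B = 1\<^sub>m n"
    using mat_mult_left_right_inverse[OF B C BC] .
  have "B \<in> Units (ring_mat TYPE(real) n ())"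
    using B C BC CB unfolding Units_def by (auto simp: ring_mat_def intro!: bexI[of _ C])
  then obtain E where E: "mat_inverse B = Some E"
    using mat_inverse(1)[OF B, where b = "()"] by (cases "mat_inverse B") auto
  from mat_inverse(2)[OF B E]
  have E': "E * B = 1\<^sub>m n" "E \<in> carrier_mat n n" by auto
  have "E = E * (B * C)" using BC E' by simp
  also have "\<dots> = (E * B) * C" using assoc_mult_mat[OF E'(2) B C] by simp
  also have "\<dots> = C" using E' C by simp
  finally show ?thesis using E by (simp add: mat_inv_def)
qed

lemma prob_space_csbm:
  assumes "\<sigma> > 0"
  shows "prob_space (csbm N C1 C2 p q mu1 mu2 \<sigma>)"
proof -
  interpret G: prob_space "measure_pmf (sbm_pmf N C1 C2 p q)"
    by (rule measure_pmf.prob_space_axioms)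
  interpret X: prob_space
    "\<Pi>\<^sub>M v\<in>{..<N}. density lborel (\<lambda>x. ennreal (normal_density (class_mean C1 mu1 mu2 v) \<sigma> x))"
    by (intro prob_space_PiM prob_space_normal_density assms)
  interpret pair_prob_space "measure_pmf (sbm_pmf N C1 C2 p q)"
    "\<Pi>\<^sub>M v\<in>{..<N}. density lborel (\<lambda>x. ennreal (normal_density (class_mean C1 mu1 mu2 v) \<sigma> x))" ..
  show ?thesis unfolding csbm_def by (rule prob_space_axioms)
qed

end

theory Submission
  imports Defs "HOL-Real_Asymp.Real_Asymp"
begin

text \<open>
  Let \<open>s = \<plusminus>1\<close> be the class vector, \<open>\<eta> = (p - q) / (p + q)\<close> and \<open>Z v = (\<Sum>u. A v u * (s u - \<eta> * s v))\<close>, which has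
  mean exactly \<open>0\<close>. If \<open>Z\<close> vanished, \<open>s\<close> would be an eigenvector of \<open>D\<^sup>-\<^sup>1A\<close> and the PPNP output would be
  explicit. In general the deviation \<open>w\<close> of the output solves \<open>(I - (1 - \<alpha>)D\<^sup>-\<^sup>1A)w = const * D\<^sup>-\<^sup>1Z\<close>, and since
  \<open>D\<^sup>-\<^sup>1A\<close> contracts the degree-weighted \<open>\<ell>\<^sup>1\<close> norm, the class averages are off by at most a multiple of
  \<open>(\<Sum>v. \<bar>Z v\<bar>) / (N * min degree)\<close>. Bernstein-type bounds with a union over the \<open>2\<^sup>N\<close> sign patterns give
  \<open>(\<Sum>v. \<bar>Z v\<bar>) \<le> 12 N sqrt (N(p + q))\<close>, and all degrees exceed \<open>N(p + q)/4\<close> since \<open>Np\<close> dominates \<open>ln N\<close>.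
\<close>

section \<open>Linear algebra: the PPNP output as the solution of a linear system\<close>

text \<open>A trivial kernel makes the determinant nonzero, hence the matrix a unit, so
  \<open>mat_inverse\<close> returns \<open>Some\<close> and \<open>mat_inv\<close> really is an
  inverse. This serves for matrices whose inverse has no explicit form to verify.\<close>

lemma mat_inv_mult:
  assumes B: "B \<in> carrier_mat n n"
    and ker: "\<And>v. v \<in> carrier_vec n \<Longrightarrow> B *\<^sub>v v = 0\<^sub>v n \<Longrightarrow> v = 0\<^sub>v n"
  shows "mat_inv B \<in> carrier_mat n n" "B * mat_inv B = 1\<^sub>m n"
proof -
  have "det B \<noteq> 0"
    using ker det_0_iff_vec_prod_zero_field[OF B] by blast
  then have "B \<in> Units (ring_mat TYPE(real) n ())"
    by (rule det_non_zero_imp_unit[OF B])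
  then obtain E where E: "mat_inverse B = Some E"
    using mat_inverse(1)[OF B, where b = "()"] by (cases "mat_inverse B") auto
  then show "mat_inv B \<in> carrier_mat n n" "B * mat_inv B = 1\<^sub>m n"
    using mat_inverse(2)[OF B E] by (auto simp: mat_inv_def)
qed

text \<open>Multiply the equation at \<open>v\<close> by \<open>d v\<close>, take absolute values
  and sum over \<open>v\<close>. By symmetry the column sums of \<open>a\<close> are again
  \<open>d\<close>, so the averaging operator does not increase the degree-weighted l1 norm, and the
  term with \<open>\<beta>\<close> can be moved to the left. With \<open>y = 0\<close> the bound
  yields injectivity; with a small \<open>y\<close> it controls the error of an approximate
  solution.\<close>

lemma random_walk_resolvent_l1:
  fixes a :: "nat \<Rightarrow> nat \<Rightarrow> real" and \<beta> :: real and N :: nat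
  defines "d \<equiv> \<lambda>v. \<Sum>u<N. a v u"
  assumes nonneg: "\<And>u v. u < N \<Longrightarrow> v < N \<Longrightarrow> a u v \<ge> 0"
    and sym: "\<And>u v. u < N \<Longrightarrow> v < N \<Longrightarrow> a u v = a v u"
    and pos: "\<And>v. v < N \<Longrightarrow> d v > 0"
    and \<beta>: "0 \<le> \<beta>"
    and eq: "\<And>v. v < N \<Longrightarrow> x v - \<beta> / d v * (\<Sum>u<N. a v u * x u) = y v"
  shows "(1 - \<beta>) * (\<Sum>v<N. d v * \<bar>x v\<bar>) \<le> (\<Sum>v<N. d v * \<bar>y v\<bar>)"
proof -
  have "d v * \<bar>x v\<bar> \<le> d v * \<bar>y v\<bar> + \<beta> * (\<Sum>u<N. a v u * \<bar>x u\<bar>)" if v: "v < N" for v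
  proof -
    have "d v * x v = d v * y v + \<beta> * (\<Sum>u<N. a v u * x u)"
      using eq[OF v] pos[OF v] by (simp add: field_simps)
    then have "d v * \<bar>x v\<bar> = \<bar>d v * y v + \<beta> * (\<Sum>u<N. a v u * x u)\<bar>"
      using pos[OF v] by (metis abs_mult abs_of_pos)
    also have "\<dots> \<le> \<bar>d v * y v\<bar> + \<bar>\<beta> * (\<Sum>u<N. a v u * x u)\<bar>"
      by (rule abs_triangle_ineq)
    also have "\<dots> = d v * \<bar>y v\<bar> + \<beta> * \<bar>\<Sum>u<N. a v u * x u\<bar>"
      using pos[OF v] \<beta> by (simp add: abs_mult)
    also have "\<bar>\<Sum>u<N. a v u * x u\<bar> \<le> (\<Sum>u<N. \<bar>a v u * x u\<bar>)"
      by (rule sum_abs)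
    also have "\<dots> = (\<Sum>u<N. a v u * \<bar>x u\<bar>)"
      using nonneg v by (intro sum.cong) (auto simp: abs_mult)
    finally show ?thesis
      using \<beta> by (simp add: mult_left_mono)
  qed
  then have "(\<Sum>v<N. d v * \<bar>x v\<bar>) \<le> (\<Sum>v<N. d v * \<bar>y v\<bar> + \<beta> * (\<Sum>u<N. a v u * \<bar>x u\<bar>))"
    by (intro sum_mono) auto
  also have "\<dots> = (\<Sum>v<N. d v * \<bar>y v\<bar>) + \<beta> * (\<Sum>v<N. \<Sum>u<N. a v u * \<bar>x u\<bar>)"
    by (simp add: sum.distrib sum_distrib_left)
  also have "(\<Sum>v<N. \<Sum>u<N. a v u * \<bar>x u\<bar>) = (\<Sum>u<N. \<Sum>v<N. a v u * \<bar>x u\<bar>)"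
    by (rule sum.swap)
  also have "\<dots> = (\<Sum>u<N. d u * \<bar>x u\<bar>)"
    unfolding d_def sum_distrib_right by (intro sum.cong) (auto simp: sym)
  finally show ?thesis
    by (simp add: algebra_simps)
qed

lemma degree_vec_nth:
  assumes "A \<in> carrier_mat N N" "v < N"
  shows "degree_vec A $ v = (\<Sum>u<N. A $$ (v, u))"
  using assms by (auto simp: degree_vec_def scalar_prod_def lessThan_atLeast0 intro!: sum.cong)

text \<open>Positive degrees make the degree matrix invertible with an explicit diagonal inverse,
  and the l1 estimate makes the kernel of \<open>I - (1 - \<alpha>)D\<^sup>-\<^sup>1A\<close>
  trivial. Hence both occurrences of \<open>mat_inv\<close> are genuine inverses, and from here on
  the output is used only through the system that it solves.\<close>

lemma ppnp_fixed_point: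
  fixes A :: "real mat"
  assumes A: "A \<in> carrier_mat N N" and y: "y \<in> carrier_vec N"
    and nonneg: "\<And>u v. u < N \<Longrightarrow> v < N \<Longrightarrow> A $$ (u, v) \<ge> 0"
    and sym: "\<And>u v. u < N \<Longrightarrow> v < N \<Longrightarrow> A $$ (u, v) = A $$ (v, u)"
    and pos: "\<And>v. v < N \<Longrightarrow> degree_vec A $ v > 0"
    and \<alpha>: "0 < \<alpha>" "\<alpha> \<le> 1" and v: "v < N"
  shows "ppnp \<alpha> A y $ v
           - (1 - \<alpha>) / degree_vec A $ v * (\<Sum>u<N. A $$ (v, u) * ppnp \<alpha> A y $ u) = \<alpha> * y $ v"
proof -
  define d where "d = (\<lambda>v. degree_vec A $ v)"
  define M where "M = 1\<^sub>m N - (1 - \<alpha>) \<cdot>\<^sub>m (mat_inv (degree_matrix A) * A)"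
  have "mat_inv (degree_matrix A) = mat_diag N (\<lambda>v. 1 / d v)"
  proof (rule mat_inv_eqI)
    have "mat_diag N (\<lambda>i. d i * (1 / d i)) = mat_diag N (\<lambda>i. 1)"
      using pos by (intro eq_matI) (auto simp: mat_diag_def d_def less_imp_neq[symmetric])
    then show "degree_matrix A * mat_diag N (\<lambda>v. 1 / d v) = 1\<^sub>m N"
      using A by (simp add: degree_matrix_def d_def)
  qed (use A in \<open>auto simp: degree_matrix_def\<close>)
  then have P: "mat_inv (degree_matrix A) * A = Matrix.mat N N (\<lambda>(i, j). A $$ (i, j) / d i)"
    using A by (simp add: mat_diag_mult_left[OF A])
  have M: "M \<in> carrier_mat N N"
    unfolding M_def P by (intro minus_carrier_mat smult_carrier_mat mat_carrier)
  have Mv: "(M *\<^sub>v x) $ i = x $ i - (1 - \<alpha>) / d i * (\<Sum>u<N. A $$ (i, u) * x $ u)"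
    if "x \<in> carrier_vec N" "i < N" for x i
  proof -
    have "(M *\<^sub>v x) $ i = (\<Sum>u<N. M $$ (i, u) * x $ u)"
      using that M by (auto simp: scalar_prod_def lessThan_atLeast0 intro!: sum.cong)
    also have "\<dots> = (\<Sum>u<N. (if i = u then x $ u else 0) - (1 - \<alpha>) / d i * (A $$ (i, u) * x $ u))"
      using that by (intro sum.cong) (auto simp: M_def P algebra_simps)
    also have "\<dots> = x $ i - (1 - \<alpha>) / d i * (\<Sum>u<N. A $$ (i, u) * x $ u)"
      using that by (simp add: sum_subtractf sum_distrib_left)
    finally show ?thesis .
  qed
  have d_sum: "d i = (\<Sum>u<N. A $$ (i, u))" if "i < N" for i
    using degree_vec_nth[OF A that] by (simp add: d_def)
  \<comment> \<open>For a kernel vector the l1 estimate has right-hand side 0, and the strictly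
    positive weights \<open>d i\<close> then force every entry to vanish.\<close>
  have inj: "x = 0\<^sub>v N" if x: "x \<in> carrier_vec N" and Mx: "M *\<^sub>v x = 0\<^sub>v N" for x
  proof -
    have "(1 - (1 - \<alpha>)) * (\<Sum>i<N. (\<Sum>u<N. A $$ (i, u)) * \<bar>x $ i\<bar>)
            \<le> (\<Sum>i<N. (\<Sum>u<N. A $$ (i, u)) * \<bar>0::real\<bar>)"
    proof (rule random_walk_resolvent_l1)
      fix i assume i: "i < N"
      show "x $ i - (1 - \<alpha>) / (\<Sum>u<N. A $$ (i, u)) * (\<Sum>u<N. A $$ (i, u) * x $ u) = 0"
        using Mv[OF x i] Mx i d_sum[OF i] by simp
    qed (use nonneg sym pos d_sum \<alpha> in \<open>auto simp: d_def\<close>)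
    then have "(\<Sum>i<N. d i * \<bar>x $ i\<bar>) \<le> 0"
      using \<alpha> by (simp add: d_sum mult_le_0_iff)
    moreover have nn: "d i * \<bar>x $ i\<bar> \<ge> 0" if "i < N" for i
      using pos[OF that] by (simp add: d_def)
    ultimately have "(\<Sum>i<N. d i * \<bar>x $ i\<bar>) = 0"
      by (intro antisym sum_nonneg) auto
    then have "\<forall>i\<in>{..<N}. d i * \<bar>x $ i\<bar> = 0"
      using nn by (subst (asm) sum_nonneg_eq_0_iff) auto
    then have "x $ i = 0" if "i < N" for i
      using pos[OF that] that by (force simp: d_def)
    then show ?thesis
      using x by (intro eq_vecI) auto
  qed
  define x where "x = mat_inv M *\<^sub>v y"
  note inv = mat_inv_mult[OF M inj]
  have x: "x \<in> carrier_vec N"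
    using inv(1) y by (auto simp: x_def)
  have "M *\<^sub>v x = y"
    using assoc_mult_mat_vec[OF M inv(1) y] inv(2) y by (simp add: x_def)
  then have *: "x $ v - (1 - \<alpha>) / d v * (\<Sum>u<N. A $$ (v, u) * x $ u) = y $ v"
    using Mv[OF x v] by simp
  have h: "ppnp \<alpha> A y $ u = \<alpha> * x $ u" if "u < N" for u
  proof -
    have "ppnp \<alpha> A y = \<alpha> \<cdot>\<^sub>v x"
      using A by (simp add: ppnp_def x_def M_def)
    then show ?thesis
      using that x by simp
  qed
  have "(\<Sum>u<N. A $$ (v, u) * ppnp \<alpha> A y $ u) = \<alpha> * (\<Sum>u<N. A $$ (v, u) * x $ u)"
    by (simp add: h sum_distrib_left mult_ac)
  then have "ppnp \<alpha> A y $ v - (1 - \<alpha>) / d v * (\<Sum>u<N. A $$ (v, u) * ppnp \<alpha> A y $ u)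
      = \<alpha> * (x $ v - (1 - \<alpha>) / d v * (\<Sum>u<N. A $$ (v, u) * x $ u))"
    by (simp add: h[OF v] right_diff_distrib)
  then show ?thesis
    using * by (simp add: d_def)
qed

section \<open>Deterministic error bound for the difference of the class averages\<close>

text \<open>The second class carries the positive sign, so that \<open>class_mean\<close> is the
  midpoint of the two means plus half of \<open>mu2 - mu1\<close> times this vector, and pairing
  with it gives a sum over \<open>C2\<close> minus a sum over \<open>C1\<close>.\<close>

definition class_sign :: "nat set \<Rightarrow> nat \<Rightarrow> real" where
  "class_sign C1 v = (if v \<in> C1 then -1 else 1)"

lemma balanced_classesD:
  assumes "balanced_classes N C1 C2"
  shows "finite C1" "finite C2" "C1 \<inter> C2 = {}" "{..<N} = C1 \<union> C2"
    "real (card C1) = real N / 2" "real (card C2) = real N / 2"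
proof -
  from assms have *: "C1 \<union> C2 = {..<N}" "C1 \<inter> C2 = {}" "2 * card C1 = N" "2 * card C2 = N"
    by (auto simp: balanced_classes_def)
  then show "C1 \<inter> C2 = {}" "{..<N} = C1 \<union> C2" by auto
  show "finite C1" "finite C2"
    using *(1) by (metis finite_Un finite_lessThan)+
  show "real (card C1) = real N / 2" "real (card C2) = real N / 2"
    using *(3,4) by linarith+
qed

lemma sum_balanced_classes:
  fixes f :: "nat \<Rightarrow> real"
  assumes "balanced_classes N C1 C2"
  shows "(\<Sum>v<N. f v) = (\<Sum>v\<in>C1. f v) + (\<Sum>v\<in>C2. f v)"
  using balanced_classesD[OF assms] by (simp add: sum.union_disjoint)

text \<open>Constants are fixed by \<open>D\<^sup>-\<^sup>1A\<close>, and the sign vector is an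
  eigenvector for \<open>\<eta>\<close> up to the residual divided by the degree. The output is
  compared with the one that an exact eigenvector would give, and the l1 estimate bounds the
  deviation. No probability enters: only the lower degree bound \<open>\<delta>\<close> and the l1
  norm of the residual do.\<close>

lemma mu_ppnp_diff_bound:
  fixes p q \<delta> :: real
  defines "\<eta> \<equiv> (p - q) / (p + q)"
  assumes A: "A \<in> carrier_mat N N"
    and nonneg: "\<And>u v. u < N \<Longrightarrow> v < N \<Longrightarrow> A $$ (u, v) \<ge> 0"
    and sym: "\<And>u v. u < N \<Longrightarrow> v < N \<Longrightarrow> A $$ (u, v) = A $$ (v, u)"
    and deg: "\<And>v. v < N \<Longrightarrow> degree_vec A $ v \<ge> \<delta>" and \<delta>: "\<delta> > 0"
    and \<alpha>: "0 < \<alpha>" "\<alpha> < 1" and pq: "0 < q" "q < p" and mu: "mu1 \<le> mu2"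
    and bal: "balanced_classes N C1 C2" and N: "N > 0"
  shows "\<bar>mu_ppnp \<alpha> N C1 mu1 mu2 A C2 - mu_ppnp \<alpha> N C1 mu1 mu2 A C1
            - (p + q) / (p + (2 - \<alpha>) / \<alpha> * q) * (mu2 - mu1)\<bar>
         \<le> (1 - \<alpha>) / \<alpha> * (mu2 - mu1) *
            (\<Sum>v<N. \<bar>\<Sum>u<N. A $$ (v, u) * (class_sign C1 u - \<eta> * class_sign C1 v)\<bar>) / (N * \<delta>)"
proof -
  define s where "s = class_sign C1"
  define Z where "Z = (\<lambda>v. \<Sum>u<N. A $$ (v, u) * (s u - \<eta> * s v))"
  define \<kappa> where "\<kappa> = 1 - (1 - \<alpha>) * \<eta>"
  define \<mu> where "\<mu> = Matrix.vec N (class_mean C1 mu1 mu2)"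
  define h where "h = (\<lambda>v. ppnp \<alpha> A \<mu> $ v)"
  define d where "d = (\<lambda>v. \<Sum>u<N. A $$ (v, u))"
  \<comment> \<open>These are the coefficients of the idealized output \<open>m + c * s\<close>: if
    \<open>s\<close> were an exact eigenvector for \<open>\<eta>\<close>, PPNP would keep constants
    and multiply \<open>s\<close> by \<open>\<alpha> / \<kappa>\<close>.\<close>
  define m c where "m = (mu1 + mu2) / 2" and "c = (mu2 - mu1) / 2 * (\<alpha> / \<kappa>)"
  define w where "w = (\<lambda>v. h v - m - c * s v)"
  have \<eta>: "0 \<le> \<eta>" "\<eta> \<le> 1"
    using pq by (auto simp: \<eta>_def field_simps)
  have "(1 - \<alpha>) * \<eta> \<le> (1 - \<alpha>) * 1"
    using \<eta> \<alpha> by (intro mult_left_mono) auto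
  then have \<kappa>: "\<alpha> \<le> \<kappa>" "\<kappa> > 0"
    using \<alpha> unfolding \<kappa>_def mult_1_right by linarith+
  have d: "degree_vec A $ v = d v" if "v < N" for v
    using degree_vec_nth[OF A that] by (simp add: d_def)
  have dpos: "d v > 0" if "v < N" for v
    using deg[OF that] \<delta> d[OF that] by simp
  have h_eq: "h v - (1 - \<alpha>) / d v * (\<Sum>u<N. A $$ (v, u) * h u) = \<alpha> * (m + (mu2 - mu1) / 2 * s v)"
    if v: "v < N" for v
  proof -
    have "\<mu> $ v = m + (mu2 - mu1) / 2 * s v"
      using v by (auto simp: \<mu>_def m_def s_def class_sign_def class_mean_def field_simps)
    then show ?thesis
      using ppnp_fixed_point[OF A _ nonneg sym, of \<mu> \<alpha> v] dpos d v \<alpha>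
      by (auto simp: h_def \<mu>_def)
  qed
  \<comment> \<open>The idealized output satisfies the equation for \<open>h\<close> except for the
    residual: \<open>m\<close> contributes \<open>\<alpha> * m\<close>, and
    \<open>c * \<kappa>\<close> matches the coefficient of \<open>s\<close> in the input. Only the
    term with \<open>Z\<close> survives.\<close>
  have w_eq: "w v - (1 - \<alpha>) / d v * (\<Sum>u<N. A $$ (v, u) * w u) = c * (1 - \<alpha>) * Z v / d v"
    if v: "v < N" for v
  proof -
    have 1: "(\<Sum>u<N. A $$ (v, u) * w u)
            = (\<Sum>u<N. A $$ (v, u) * h u) - m * d v - c * (\<Sum>u<N. A $$ (v, u) * s u)"
      by (simp add: w_def d_def algebra_simps sum_subtractf sum.distrib sum_distrib_left)
    have 2: "(\<Sum>u<N. A $$ (v, u) * s u) = Z v + \<eta> * s v * d v"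
      by (simp add: Z_def d_def algebra_simps sum_subtractf sum_distrib_left)
    have 3: "c * \<kappa> = \<alpha> * ((mu2 - mu1) / 2)"
      using \<kappa> by (simp add: c_def)
    have 4: "w v = h v - m - c * s v"
      by (simp add: w_def)
    have "w v - (1 - \<alpha>) / d v * (\<Sum>u<N. A $$ (v, u) * w u)
        = (h v - (1 - \<alpha>) / d v * (\<Sum>u<N. A $$ (v, u) * h u)) - \<alpha> * m
           - c * \<kappa> * s v + c * (1 - \<alpha>) * Z v / d v"
      using dpos[OF v] unfolding 1 2 4 \<kappa>_def by (simp add: field_simps)
    then show ?thesis
      unfolding h_eq[OF v] 3 by (simp add: algebra_simps)
  qed
  have c0: "c \<ge> 0"
    using mu \<alpha> \<kappa> by (simp add: c_def)
  have "(1 - (1 - \<alpha>)) * (\<Sum>v<N. d v * \<bar>w v\<bar>) \<le> (\<Sum>v<N. d v * \<bar>c * (1 - \<alpha>) * Z v / d v\<bar>)"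
    unfolding d_def
    by (rule random_walk_resolvent_l1)
      (use nonneg sym dpos \<alpha> w_eq in \<open>auto simp: d_def\<close>)
  \<comment> \<open>The weight \<open>d v\<close> cancels the division by the degree, which leaves
    the unweighted l1 norm of the residual.\<close>
  also have "\<dots> = (\<Sum>v<N. c * (1 - \<alpha>) * \<bar>Z v\<bar>)"
  proof (intro sum.cong refl)
    fix v assume "v \<in> {..<N}"
    then have "d v > 0" using dpos by simp
    then show "d v * \<bar>c * (1 - \<alpha>) * Z v / d v\<bar> = c * (1 - \<alpha>) * \<bar>Z v\<bar>"
      using c0 \<alpha> by (simp add: abs_mult)
  qed
  also have "\<dots> = c * (1 - \<alpha>) * (\<Sum>v<N. \<bar>Z v\<bar>)"
    by (simp add: sum_distrib_left)
  finally have W: "\<alpha> * (\<Sum>v<N. d v * \<bar>w v\<bar>) \<le> c * (1 - \<alpha>) * (\<Sum>v<N. \<bar>Z v\<bar>)"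
    by simp
  have "\<delta> * (\<Sum>v<N. \<bar>w v\<bar>) \<le> (\<Sum>v<N. d v * \<bar>w v\<bar>)"
    unfolding sum_distrib_left using deg d by (intro sum_mono mult_right_mono) auto
  then have "\<alpha> * (\<delta> * (\<Sum>v<N. \<bar>w v\<bar>)) \<le> \<alpha> * (\<Sum>v<N. d v * \<bar>w v\<bar>)"
    using \<alpha> by (intro mult_left_mono) auto
  also note W
  finally have W': "(\<Sum>v<N. \<bar>w v\<bar>) \<le> c * (1 - \<alpha>) * (\<Sum>v<N. \<bar>Z v\<bar>) / (\<alpha> * \<delta>)"
    using \<alpha> \<delta> by (simp add: field_simps)
  note bD = balanced_classesD[OF bal]
  have C2: "v \<notin> C1" if "v \<in> C2" for v
    using bD(3) that by auto
  \<comment> \<open>Pairing the deviation with \<open>s\<close> isolates the difference of the class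
    sums: \<open>m\<close> cancels because the classes have equal size, and \<open>c * s\<close>
    contributes \<open>N * c\<close>.\<close>
  have "(\<Sum>v<N. s v * w v) = (\<Sum>v\<in>C2. w v) - (\<Sum>v\<in>C1. w v)"
    unfolding sum_balanced_classes[OF bal]
    by (simp add: s_def class_sign_def C2 sum_negf)
  also have "\<dots> = (\<Sum>v\<in>C2. h v - m - c) - (\<Sum>v\<in>C1. h v - m + c)"
    by (simp add: w_def s_def class_sign_def C2)
  also have "\<dots> = (\<Sum>v\<in>C2. h v) - (\<Sum>v\<in>C1. h v) - real N * c"
    by (simp add: sum_subtractf sum.distrib bD(5,6) field_simps)
  finally have sw: "(\<Sum>v<N. s v * w v) = (\<Sum>v\<in>C2. h v) - (\<Sum>v\<in>C1. h v) - real N * c" .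
  \<comment> \<open>The stated factor is \<open>\<alpha> / \<kappa>\<close>, since
    \<open>\<kappa> * (p + q) = \<alpha> * p + (2 - \<alpha>) * q\<close>.\<close>
  have main: "(p + q) / (p + (2 - \<alpha>) / \<alpha> * q) * (mu2 - mu1) = 2 * c"
  proof -
    have "\<kappa> * (p + q) = \<alpha> * (p + (2 - \<alpha>) / \<alpha> * q)"
      using pq \<alpha> by (simp add: \<kappa>_def \<eta>_def field_simps)
    moreover have "p + (2 - \<alpha>) / \<alpha> * q > 0"
      using pq \<alpha> by (intro add_pos_pos mult_pos_pos divide_pos_pos) auto
    ultimately have "(p + q) / (p + (2 - \<alpha>) / \<alpha> * q) = \<alpha> / \<kappa>"
      using \<kappa> by (subst frac_eq_eq) (auto simp: mult.commute)
    then show ?thesis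
      by (simp add: c_def)
  qed
  have "mu_ppnp \<alpha> N C1 mu1 mu2 A C2 - mu_ppnp \<alpha> N C1 mu1 mu2 A C1
          - (p + q) / (p + (2 - \<alpha>) / \<alpha> * q) * (mu2 - mu1) = 2 / real N * (\<Sum>v<N. s v * w v)"
    unfolding main sw using N by (simp add: mu_ppnp_def h_def \<mu>_def field_simps)
  also have "\<bar>\<dots>\<bar> = 2 / real N * \<bar>\<Sum>v<N. s v * w v\<bar>"
    by (simp add: abs_mult)
  also have "\<dots> \<le> 2 / real N * (\<Sum>v<N. \<bar>w v\<bar>)"
  proof (intro mult_left_mono)
    have "\<bar>\<Sum>v<N. s v * w v\<bar> \<le> (\<Sum>v<N. \<bar>s v * w v\<bar>)"
      by (rule sum_abs)
    also have "\<dots> = (\<Sum>v<N. \<bar>w v\<bar>)"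
      by (intro sum.cong) (auto simp: s_def class_sign_def)
    finally show "\<bar>\<Sum>v<N. s v * w v\<bar> \<le> (\<Sum>v<N. \<bar>w v\<bar>)" .
  qed auto
  also have "\<dots> \<le> 2 / real N * (c * (1 - \<alpha>) * (\<Sum>v<N. \<bar>Z v\<bar>) / (\<alpha> * \<delta>))"
    using W' by (intro mult_left_mono) auto
  also have "\<dots> = (1 - \<alpha>) / \<kappa> * (mu2 - mu1) * (\<Sum>v<N. \<bar>Z v\<bar>) / (N * \<delta>)"
    using \<alpha> by (simp add: c_def mult_ac)
  \<comment> \<open>Replacing \<open>\<kappa>\<close> by its lower bound \<open>\<alpha>\<close>
    removes \<open>p\<close> and \<open>q\<close> from the prefactor, so that it can serve as a
    constant uniform in \<open>N\<close>.\<close>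
  also have "\<dots> \<le> (1 - \<alpha>) / \<alpha> * (mu2 - mu1) * (\<Sum>v<N. \<bar>Z v\<bar>) / (N * \<delta>)"
    using \<alpha> \<kappa> mu \<delta> by (intro divide_right_mono mult_right_mono divide_left_mono) (auto intro: sum_nonneg)
  finally show ?thesis
    by (simp add: Z_def s_def)
qed

section \<open>Exponential moments and tails of independent Bernoulli sums\<close>

text \<open>For negative \<open>x = - y\<close>, multiply by \<open>1 + y\<close>: the product
  \<open>(1 - y + y\<^sup>2) * (1 + y) = 1 + y ^ 3\<close> is at least 1, and
  \<open>1 + y \<le> exp y\<close>.\<close>

lemma exp_le_quadratic:
  fixes x :: real
  assumes "\<bar>x\<bar> \<le> 1"
  shows "exp x \<le> 1 + x + x\<^sup>2"
proof (cases "x \<ge> 0")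
  case True
  then show ?thesis using assms exp_bound[of x] by simp
next
  case False
  define y where "y = - x"
  have y: "y > 0" using False by (simp add: y_def)
  have "1 \<le> 1 + y ^ 3"
    using y by simp
  also have "\<dots> = (1 - y + y\<^sup>2) * (1 + y)"
    by (simp add: algebra_simps power2_eq_square power3_eq_cube)
  also have "\<dots> \<le> (1 - y + y\<^sup>2) * exp y"
  proof (rule mult_left_mono)
    show "0 \<le> 1 - y + y\<^sup>2"
      using sum_power2_ge_zero[of "y - 1" 0] y by (simp add: power2_eq_square algebra_simps)
  qed (simp add: exp_ge_add_one_self)
  finally show ?thesis
    by (simp add: y_def exp_minus field_simps)
qed

lemma finite_set_Pi_pmf_bool:
  "finite I \<Longrightarrow> finite (set_pmf (Pi_pmf I d (b :: _ \<Rightarrow> bool pmf)))"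
  by (subst set_Pi_pmf) auto

text \<open>Markov's inequality is applied to the exponential of \<open>\<theta>\<close> times the
  centred sum, whose expectation factorizes by independence. Keeping \<open>\<pi> i\<close> in the
  exponent makes the bound scale with the variance instead of the number of variables, which is what
  sparse graphs require.\<close>

lemma Bernoulli_sum_tail:
  fixes \<pi> a :: "'i \<Rightarrow> real" and \<theta> t :: real and I :: "'i set"
  defines "E \<equiv> Pi_pmf I False (\<lambda>i. bernoulli_pmf (\<pi> i))"
  assumes I: "finite I"
    and \<pi>: "\<And>i. i \<in> I \<Longrightarrow> 0 \<le> \<pi> i \<and> \<pi> i \<le> 1"
    and a: "\<And>i. i \<in> I \<Longrightarrow> \<bar>\<theta> * a i\<bar> \<le> 1" and \<theta>: "0 < \<theta>"
  shows "measure_pmf.prob E {e. (\<Sum>i\<in>I. a i * (of_bool (e i) - \<pi> i)) \<ge> t}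
           \<le> exp (\<theta>\<^sup>2 * (\<Sum>i\<in>I. \<pi> i * (a i)\<^sup>2) - \<theta> * t)"
proof -
  define f where "f = (\<lambda>i b. exp (\<theta> * (a i * (of_bool b - \<pi> i))))"
  define u where "u = (\<lambda>e. \<Prod>i\<in>I. f i (e i))"
  have fin: "finite (set_pmf E)"
    unfolding E_def by (rule finite_set_Pi_pmf_bool[OF I])
  have u: "u e = exp (\<theta> * (\<Sum>i\<in>I. a i * (of_bool (e i) - \<pi> i)))" for e
    by (simp add: u_def f_def sum_distrib_left exp_sum I)
  have f: "measure_pmf.expectation (bernoulli_pmf (\<pi> i)) (f i) \<le> exp (\<theta>\<^sup>2 * (\<pi> i * (a i)\<^sup>2))"
    if i: "i \<in> I" for i
  proof -
    define x where "x = \<theta> * a i"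
    have x: "exp x \<le> 1 + x + x\<^sup>2"
      using a[OF i] by (intro exp_le_quadratic) (simp add: x_def)
    have "measure_pmf.expectation (bernoulli_pmf (\<pi> i)) (f i)
            = \<pi> i * exp (x * (1 - \<pi> i)) + (1 - \<pi> i) * exp (- (x * \<pi> i))"
      using \<pi>[OF i] by (simp add: f_def x_def mult_ac)
    \<comment> \<open>With the centring factored out, the second factor is at most
      \<open>exp (\<pi> i * (x + x\<^sup>2))\<close>; the linear terms then cancel and only the
      quadratic one remains.\<close>
    also have "\<dots> = exp (- (x * \<pi> i)) * (1 + \<pi> i * (exp x - 1))"
      by (simp add: algebra_simps exp_diff exp_minus field_simps)
    also have "\<dots> \<le> exp (- (x * \<pi> i)) * exp (\<pi> i * (x + x\<^sup>2))"
    proof (rule mult_left_mono)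
      have "1 + \<pi> i * (exp x - 1) \<le> 1 + \<pi> i * (x + x\<^sup>2)"
        using x \<pi>[OF i] by (intro add_left_mono mult_left_mono) auto
      also have "\<dots> \<le> exp (\<pi> i * (x + x\<^sup>2))"
        by (rule exp_ge_add_one_self)
      finally show "1 + \<pi> i * (exp x - 1) \<le> exp (\<pi> i * (x + x\<^sup>2))" .
    qed auto
    also have "\<dots> = exp (\<theta>\<^sup>2 * (\<pi> i * (a i)\<^sup>2))"
      by (simp add: x_def algebra_simps power2_eq_square flip: exp_add)
    finally show ?thesis .
  qed
  have "measure_pmf.expectation E u = (\<Prod>i\<in>I. measure_pmf.expectation (bernoulli_pmf (\<pi> i)) (f i))"
    unfolding E_def u_def
    by (rule expectation_prod_Pi_pmf[OF I]) (auto simp: f_def intro: integrable_measure_pmf_finite)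
  also have "\<dots> \<le> (\<Prod>i\<in>I. exp (\<theta>\<^sup>2 * (\<pi> i * (a i)\<^sup>2)))"
    by (intro prod_mono conjI f integral_nonneg_AE) (auto simp: f_def)
  also have "\<dots> = exp (\<theta>\<^sup>2 * (\<Sum>i\<in>I. \<pi> i * (a i)\<^sup>2))"
    by (simp add: exp_sum I sum_distrib_left)
  finally have mgf: "measure_pmf.expectation E u \<le> exp (\<theta>\<^sup>2 * (\<Sum>i\<in>I. \<pi> i * (a i)\<^sup>2))" .
  have "measure_pmf.prob E {e. (\<Sum>i\<in>I. a i * (of_bool (e i) - \<pi> i)) \<ge> t}
          = measure_pmf.prob E {e \<in> space E. u e \<ge> exp (\<theta> * t)}"
    using \<theta> by (simp add: u)
  also have "\<dots> \<le> measure_pmf.expectation E u / exp (\<theta> * t)"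
    by (rule integral_Markov_inequality_measure[where A = UNIV])
      (auto simp: u intro: integrable_measure_pmf_finite[OF fin])
  also have "\<dots> \<le> exp (\<theta>\<^sup>2 * (\<Sum>i\<in>I. \<pi> i * (a i)\<^sup>2)) / exp (\<theta> * t)"
    by (intro divide_right_mono mgf) auto
  finally show ?thesis
    by (simp add: exp_diff)
qed

section \<open>Sums over matrix entries in terms of independent edge variables\<close>

definition upper_pairs :: "nat \<Rightarrow> (nat \<times> nat) set" where
  "upper_pairs N = {(u, v). u \<le> v \<and> v < N}"

text \<open>The coefficient that an edge variable receives when a sum over all matrix entries is
  collected by edges: an off-diagonal variable fills two entries, a self-loop only one.\<close>

definition fold_pairs :: "(nat \<Rightarrow> nat \<Rightarrow> real) \<Rightarrow> nat \<times> nat \<Rightarrow> real" where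
  "fold_pairs c = (\<lambda>(u, v). if u = v then c u u else c u v + c v u)"

lemma finite_upper_pairs [simp]: "finite (upper_pairs N)"
  by (rule finite_subset[of _ "{..<N} \<times> {..<N}"]) (auto simp: upper_pairs_def)

text \<open>Grouping by the larger node means that passing from \<open>N\<close> to
  \<open>Suc N\<close> appends a single column, which is the form needed for induction on
  \<open>N\<close>.\<close>

lemma sum_upper_pairs:
  "sum f (upper_pairs N) = (\<Sum>v<N. \<Sum>u\<le>v. f (u, v))" for f :: "nat \<times> nat \<Rightarrow> real"
proof -
  have "upper_pairs N = (\<lambda>(v, u). (u, v)) ` Sigma {..<N} (\<lambda>v. {..v})"
    by (force simp: upper_pairs_def)
  then have "sum f (upper_pairs N) = sum (f \<circ> (\<lambda>(v, u). (u, v))) (Sigma {..<N} (\<lambda>v. {..v}))"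
    by (simp only:) (rule sum.reindex, auto simp: inj_on_def)
  then show ?thesis
    by (simp add: sum.Sigma split_def comp_def)
qed

text \<open>In the induction step the square gains a row, a column and a corner. Row and column
  carry the same values of \<open>f\<close>, so they merge into the folded coefficients of the new
  column of pairs.\<close>

lemma sum_fold_pairs:
  fixes c :: "nat \<Rightarrow> nat \<Rightarrow> real"
  shows "(\<Sum>u<N. \<Sum>v<N. c u v * f (min u v, max u v)) = (\<Sum>i\<in>upper_pairs N. fold_pairs c i * f i)"
  unfolding sum_upper_pairs
proof (induction N)
  case (Suc N)
  have "(\<Sum>u\<le>N. fold_pairs c (u, N) * f (u, N))
      = (\<Sum>u<N. (c u N + c N u) * f (u, N)) + c N N * f (N, N)"
    by (simp add: fold_pairs_def flip: lessThan_Suc_atMost)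
  also have "\<dots> = (\<Sum>u<N. c u N * f (min u N, max u N)) + (\<Sum>u<N. c N u * f (min N u, max N u))
                   + c N N * f (N, N)"
    by (simp add: distrib_right sum.distrib)
  finally show ?case
    using Suc by (simp add: sum.distrib)
qed simp

text \<open>Entries \<open>(u, v)\<close> and \<open>(v, u)\<close> share one variable, so the
  double sum is first folded onto independent edges. This costs a factor 2 twice: folded
  coefficients are bounded by \<open>2 * k\<close>, and
  \<open>(a + b)\<^sup>2 \<le> 2 * a\<^sup>2 + 2 * b\<^sup>2\<close> doubles the variance
  term.\<close>

lemma symmetric_Bernoulli_tail:
  fixes \<pi> c :: "nat \<Rightarrow> nat \<Rightarrow> real" and \<theta> t k :: real and N :: nat
  defines "E \<equiv> Pi_pmf (upper_pairs N) False (\<lambda>(u, v). bernoulli_pmf (\<pi> u v))"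
  assumes \<pi>: "\<And>u v. 0 \<le> \<pi> u v \<and> \<pi> u v \<le> 1" and sym: "\<And>u v. \<pi> u v = \<pi> v u"
    and c: "\<And>u v. \<bar>c u v\<bar> \<le> k" and \<theta>: "0 < \<theta>" "\<theta> * (2 * k) \<le> 1"
  shows "measure_pmf.prob E
           {e. (\<Sum>u<N. \<Sum>v<N. c u v * (of_bool (e (min u v, max u v)) - \<pi> u v)) \<ge> t}
           \<le> exp (2 * \<theta>\<^sup>2 * (\<Sum>u<N. \<Sum>v<N. \<pi> u v * (c u v)\<^sup>2) - \<theta> * t)"
proof -
  define \<pi>' where "\<pi>' = (\<lambda>(u, v). \<pi> u v)"
  define a where "a = fold_pairs c"
  have \<pi>': "\<pi>' (min u v, max u v) = \<pi> u v" for u v :: nat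
    by (auto simp: \<pi>'_def min_def max_def sym)
  have E: "E = Pi_pmf (upper_pairs N) False (\<lambda>i. bernoulli_pmf (\<pi>' i))"
    by (simp add: E_def \<pi>'_def split_def)
  have "(\<Sum>i\<in>upper_pairs N. \<pi>' i * (a i)\<^sup>2)
          \<le> (\<Sum>i\<in>upper_pairs N. fold_pairs (\<lambda>u v. 2 * (c u v)\<^sup>2) i * \<pi>' i)"
  proof (rule sum_mono)
    fix i :: "nat \<times> nat"
    obtain u v where i: "i = (u, v)" by fastforce
    have "(c u v + c v u)\<^sup>2 \<le> 2 * (c u v)\<^sup>2 + 2 * (c v u)\<^sup>2"
      using zero_le_power2[of "c u v - c v u"] by (simp add: power2_eq_square algebra_simps)
    then have "(a i)\<^sup>2 \<le> fold_pairs (\<lambda>u v. 2 * (c u v)\<^sup>2) i"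
      by (simp add: a_def i fold_pairs_def)
    then show "\<pi>' i * (a i)\<^sup>2 \<le> fold_pairs (\<lambda>u v. 2 * (c u v)\<^sup>2) i * \<pi>' i"
      using \<pi> by (auto simp: i \<pi>'_def intro: mult_left_mono simp: mult.commute)
  qed
  also have "\<dots> = (\<Sum>u<N. \<Sum>v<N. 2 * (c u v)\<^sup>2 * \<pi>' (min u v, max u v))"
    by (rule sum_fold_pairs[symmetric])
  also have "\<dots> = 2 * (\<Sum>u<N. \<Sum>v<N. \<pi> u v * (c u v)\<^sup>2)"
    by (simp add: \<pi>' sum_distrib_left mult_ac)
  finally have var: "(\<Sum>i\<in>upper_pairs N. \<pi>' i * (a i)\<^sup>2) \<le> 2 * (\<Sum>u<N. \<Sum>v<N. \<pi> u v * (c u v)\<^sup>2)" .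
  have "(\<Sum>u<N. \<Sum>v<N. c u v * (of_bool (e (min u v, max u v)) - \<pi> u v))
      = (\<Sum>i\<in>upper_pairs N. a i * (of_bool (e i) - \<pi>' i))" for e
    using sum_fold_pairs[where N = N and c = c and f = "\<lambda>i. of_bool (e i) - \<pi>' i"] by (simp add: \<pi>' a_def)
  then have "measure_pmf.prob E
           {e. (\<Sum>u<N. \<Sum>v<N. c u v * (of_bool (e (min u v, max u v)) - \<pi> u v)) \<ge> t}
      = measure_pmf.prob E {e. (\<Sum>i\<in>upper_pairs N. a i * (of_bool (e i) - \<pi>' i)) \<ge> t}"
    by simp
  also have "\<dots> \<le> exp (\<theta>\<^sup>2 * (\<Sum>i\<in>upper_pairs N. \<pi>' i * (a i)\<^sup>2) - \<theta> * t)"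
    unfolding E
  proof (rule Bernoulli_sum_tail)
    fix i :: "nat \<times> nat"
    obtain u v where i: "i = (u, v)" by fastforce
    show "0 \<le> \<pi>' i \<and> \<pi>' i \<le> 1"
      using \<pi> by (simp add: i \<pi>'_def)
    have "\<bar>a i\<bar> \<le> 2 * k"
      using c[of u v] c[of v u] by (auto simp: a_def i fold_pairs_def)
    then have "\<theta> * \<bar>a i\<bar> \<le> \<theta> * (2 * k)"
      using \<theta> by (intro mult_left_mono) auto
    then have "\<theta> * \<bar>a i\<bar> \<le> 1"
      using \<theta>(2) by (rule order_trans)
    then show "\<bar>\<theta> * a i\<bar> \<le> 1"
      using \<theta> by (simp add: abs_mult)
  qed (use \<theta> in auto)
  also have "\<dots> \<le> exp (\<theta>\<^sup>2 * (2 * (\<Sum>u<N. \<Sum>v<N. \<pi> u v * (c u v)\<^sup>2)) - \<theta> * t)"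
    using var by (simp add: mult_left_mono)
  finally show ?thesis
    by (simp add: mult_ac)
qed

section \<open>Concentration of degrees and class residuals in the block model\<close>

lemma edge_prob_commute: "edge_prob C1 C2 p q u v = edge_prob C1 C2 p q v u"
  by (auto simp: edge_prob_def)

text \<open>Each node sees \<open>N / 2\<close> nodes of either class, itself included because
  self-loops are allowed. The row sums are therefore exact, and the sign vector is an exact
  eigenvector of the matrix of edge probabilities.\<close>

lemma edge_prob_sums:
  assumes bal: "balanced_classes N C1 C2" and v: "v < N"
  shows "(\<Sum>u<N. edge_prob C1 C2 p q v u) = real N * (p + q) / 2"
    and "(\<Sum>u<N. edge_prob C1 C2 p q v u * class_sign C1 u) = real N * (p - q) / 2 * class_sign C1 v"
proof -
  note bD = balanced_classesD[OF bal]
  have disj: "u \<in> C1 \<Longrightarrow> u \<notin> C2" "u \<in> C2 \<Longrightarrow> u \<notin> C1" for u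
    using bD(3) by auto
  have v': "v \<in> C1 \<or> v \<in> C2"
    using v bD(4) by auto
  show "(\<Sum>u<N. edge_prob C1 C2 p q v u) = real N * (p + q) / 2"
    unfolding sum_balanced_classes[OF bal]
    using v'
    by (elim disjE) (simp_all add: edge_prob_def disj bD(5,6) field_simps)
  show "(\<Sum>u<N. edge_prob C1 C2 p q v u * class_sign C1 u) = real N * (p - q) / 2 * class_sign C1 v"
    unfolding sum_balanced_classes[OF bal]
    using v'
    by (elim disjE) (simp_all add: edge_prob_def class_sign_def disj bD(5,6) field_simps)
qed

abbreviation edge_indicators ::
  "nat \<Rightarrow> nat set \<Rightarrow> nat set \<Rightarrow> real \<Rightarrow> real \<Rightarrow> (nat \<times> nat \<Rightarrow> bool) pmf" where
  "edge_indicators N C1 C2 p q \<equiv>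
     Pi_pmf (upper_pairs N) False (\<lambda>(u, v). bernoulli_pmf (edge_prob C1 C2 p q u v))"

lemma sbm_pmf_edge_indicators:
  "sbm_pmf N C1 C2 p q = map_pmf (adjacency_matrix N) (edge_indicators N C1 C2 p q)"
  by (simp add: sbm_pmf_def upper_pairs_def)

lemma adjacency_matrix_carrier [simp]: "adjacency_matrix N e \<in> carrier_mat N N"
  by (simp add: adjacency_matrix_def)

lemma adjacency_matrix_nth [simp]:
  "u < N \<Longrightarrow> v < N \<Longrightarrow> adjacency_matrix N e $$ (u, v) = of_bool (e (min u v, max u v))"
  by (simp add: adjacency_matrix_def)

text \<open>The threshold is half of the mean degree, so this is a lower tail, obtained from the
  upper tail bound with coefficient -1 on row \<open>w\<close> and 0 elsewhere.\<close>

lemma degree_tail: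
  assumes bal: "balanced_classes N C1 C2" and pq: "0 \<le> p" "p \<le> 1" "0 \<le> q" "q \<le> 1" and w: "w < N"
  shows "measure_pmf.prob (edge_indicators N C1 C2 p q)
           {e. degree_vec (adjacency_matrix N e) $ w \<le> real N * (p + q) / 4}
         \<le> exp (- (real N * (p + q) / 64))"
proof -
  define m where "m = real N * (p + q) / 2"
  define c where "c = (\<lambda>u v :: nat. if u = w then - 1 else 0 :: real)"
  have c_sum: "(\<Sum>u<N. \<Sum>v<N. c u v * f u v) = - (\<Sum>v<N. f w v)" for f
  proof -
    have "(\<Sum>u<N. \<Sum>v<N. c u v * f u v) = (\<Sum>u<N. if u = w then - (\<Sum>v<N. f u v) else 0)"
      by (intro sum.cong) (auto simp: c_def sum_negf)
    then show ?thesis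
      using w by simp
  qed
  have "{e. degree_vec (adjacency_matrix N e) $ w \<le> real N * (p + q) / 4}
      = {e. (\<Sum>u<N. \<Sum>v<N. c u v * (of_bool (e (min u v, max u v)) - edge_prob C1 C2 p q u v)) \<ge> m / 2}"
    unfolding c_sum using w
    by (auto simp: degree_vec_nth[OF adjacency_matrix_carrier w] sum_subtractf
        edge_prob_sums[OF bal w] m_def)
  \<comment> \<open>The choice \<open>\<theta> = 1/8\<close> makes the exponent
    \<open>m / 32 - m / 16 = - m / 32\<close>, as the variance sum turns out to be
    \<open>m\<close>.\<close>
  also have "measure_pmf.prob (edge_indicators N C1 C2 p q) \<dots>
      \<le> exp (2 * (1/8)\<^sup>2 * (\<Sum>u<N. \<Sum>v<N. edge_prob C1 C2 p q u v * (c u v)\<^sup>2) - 1/8 * (m / 2))"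
    by (rule symmetric_Bernoulli_tail[where k = 1])
      (use pq in \<open>auto simp: edge_prob_def c_def\<close>)
  \<comment> \<open>The coefficients are 0 or -1, so \<open>(c u v)\<^sup>2 = - c u v\<close> and
    \<open>c_sum\<close> applies again.\<close>
  also have "(\<Sum>u<N. \<Sum>v<N. edge_prob C1 C2 p q u v * (c u v)\<^sup>2)
           = (\<Sum>u<N. \<Sum>v<N. c u v * (- edge_prob C1 C2 p q u v))"
    by (intro sum.cong) (auto simp: c_def)
  also have "\<dots> = m"
    unfolding c_sum by (simp add: sum_negf edge_prob_sums[OF bal w] m_def)
  finally show ?thesis
    by (simp add: m_def power2_eq_square)
qed

text \<open>The degree of \<open>v\<close> times the error at \<open>v\<close> in the eigenvector
  equation of \<open>D\<^sup>-\<^sup>1A\<close> for the sign vector and the eigenvalue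
  \<open>\<eta>\<close>.\<close>

definition class_residual :: "nat \<Rightarrow> nat set \<Rightarrow> real \<Rightarrow> real mat \<Rightarrow> nat \<Rightarrow> real" where
  "class_residual N C1 \<eta> A v = (\<Sum>u<N. A $$ (v, u) * (class_sign C1 u - \<eta> * class_sign C1 v))"

text \<open>For fixed weights \<open>t\<close> the sum is linear in the edge variables and has mean
  0. The constant 12 is large enough for the decay rate 11/4 to beat the \<open>2 ^ N\<close> sign
  patterns of a later union bound.\<close>

lemma class_residual_signed_tail:
  fixes t :: "nat \<Rightarrow> real" and p q :: real
  assumes bal: "balanced_classes N C1 C2" and pq: "0 \<le> q" "q < p" "p \<le> 1"
    and t: "\<And>v. \<bar>t v\<bar> \<le> 1" and large: "1 \<le> real N * (p + q)"
  shows "measure_pmf.prob (edge_indicators N C1 C2 p q)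
           {e. (\<Sum>v<N. t v * class_residual N C1 ((p - q) / (p + q)) (adjacency_matrix N e) v)
                 \<ge> 12 * real N * sqrt (real N * (p + q))}
         \<le> exp (- (11 / 4 * real N))"
proof -
  define \<eta> where "\<eta> = (p - q) / (p + q)"
  define s where "s = class_sign C1"
  define m where "m = real N * (p + q)"
  define c where "c = (\<lambda>v u. t v * (s u - \<eta> * s v))"
  \<comment> \<open>The variance sum is at most \<open>2 * N * m\<close>, so this choice gives the
    exponent \<open>N / 4 - 3 * N\<close>. The side condition \<open>\<theta> * 4 \<le> 1\<close> is
    where \<open>m \<ge> 1\<close> enters.\<close>
  define \<theta> where "\<theta> = 1 / (4 * sqrt m)"
  note sums = edge_prob_sums[OF bal, where p = p and q = q]
  have \<eta>: "0 \<le> \<eta>" "\<eta> \<le> 1"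
    using pq by (auto simp: \<eta>_def field_simps)
  have c: "\<bar>c v u\<bar> \<le> 2" for v u
  proof -
    have "\<bar>s u - \<eta> * s v\<bar> \<le> 2"
      using \<eta> by (auto simp: s_def class_sign_def)
    then have "\<bar>t v\<bar> * \<bar>s u - \<eta> * s v\<bar> \<le> 1 * 2"
      using t[of v] by (intro mult_mono) auto
    then show ?thesis
      by (simp add: c_def abs_mult)
  qed
  have m: "1 \<le> m" "1 \<le> sqrt m"
    using large by (auto simp: m_def)
  then have \<theta>: "0 < \<theta>" "\<theta> * (2 * 2) \<le> 1"
    by (auto simp: \<theta>_def field_simps)
  \<comment> \<open>Here \<open>\<eta>\<close> is seen to be the right value: it is the ratio of the
    two row sums in \<open>edge_prob_sums\<close>. The edge variables may therefore be centred at no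
    cost.\<close>
  have mean: "(\<Sum>u<N. c v u * edge_prob C1 C2 p q v u) = 0" if "v < N" for v
  proof -
    have "(\<Sum>u<N. c v u * edge_prob C1 C2 p q v u)
        = t v * ((\<Sum>u<N. edge_prob C1 C2 p q v u * s u) - \<eta> * s v * (\<Sum>u<N. edge_prob C1 C2 p q v u))"
      by (simp add: c_def algebra_simps sum_subtractf sum_distrib_left)
    also have "\<dots> = t v * (real N / 2 * s v * ((p - q) - \<eta> * (p + q)))"
      unfolding s_def sums[OF that] by (simp add: field_simps)
    also have "(p - q) - \<eta> * (p + q) = 0"
      using pq by (simp add: \<eta>_def)
    finally show ?thesis by simp
  qed
  have "(\<Sum>v<N. t v * class_residual N C1 \<eta> (adjacency_matrix N e) v)
      = (\<Sum>v<N. \<Sum>u<N. c v u * (of_bool (e (min v u, max v u)) - edge_prob C1 C2 p q v u))" for e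
  proof (rule sum.cong[OF refl])
    fix v assume "v \<in> {..<N}"
    then have v: "v < N" by simp
    have "t v * class_residual N C1 \<eta> (adjacency_matrix N e) v
        = (\<Sum>u<N. c v u * of_bool (e (min v u, max v u)))"
      unfolding class_residual_def sum_distrib_left
      using v by (intro sum.cong) (auto simp: c_def s_def)
    then show "t v * class_residual N C1 \<eta> (adjacency_matrix N e) v
        = (\<Sum>u<N. c v u * (of_bool (e (min v u, max v u)) - edge_prob C1 C2 p q v u))"
      using mean[OF v] by (simp add: right_diff_distrib sum_subtractf)
  qed
  then have "measure_pmf.prob (edge_indicators N C1 C2 p q)
           {e. (\<Sum>v<N. t v * class_residual N C1 \<eta> (adjacency_matrix N e) v) \<ge> 12 * real N * sqrt m}
      \<le> exp (2 * \<theta>\<^sup>2 * (\<Sum>v<N. \<Sum>u<N. edge_prob C1 C2 p q v u * (c v u)\<^sup>2) - \<theta> * (12 * real N * sqrt m))"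
    using symmetric_Bernoulli_tail[of "edge_prob C1 C2 p q" c 2 \<theta> N] c \<theta> pq edge_prob_commute
    by (simp add: edge_prob_def)
  also have "\<dots> \<le> exp (2 * \<theta>\<^sup>2 * (2 * real N * m) - \<theta> * (12 * real N * sqrt m))"
  proof -
    have "(\<Sum>v<N. \<Sum>u<N. edge_prob C1 C2 p q v u * (c v u)\<^sup>2) \<le> (\<Sum>v<N. \<Sum>u<N. edge_prob C1 C2 p q v u * 4)"
    proof (intro sum_mono mult_left_mono)
      show "(c v u)\<^sup>2 \<le> 4" for v u
        using power_mono[OF c[of v u], of 2] by simp
    qed (use pq in \<open>auto simp: edge_prob_def\<close>)
    also have "\<dots> = (\<Sum>v<N. real N * (p + q) / 2 * 4)"
      by (intro sum.cong refl) (simp add: sums(1) flip: sum_distrib_right)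
    also have "\<dots> = 2 * real N * m"
      by (simp add: m_def)
    finally show ?thesis
      unfolding exp_le_cancel_iff by (intro diff_right_mono mult_left_mono) auto
  qed
  also have "2 * \<theta>\<^sup>2 * (2 * real N * m) - \<theta> * (12 * real N * sqrt m) = - (11 / 4 * real N)"
    using m by (simp add: \<theta>_def power_divide power_mult_distrib)
  finally show ?thesis
    by (simp add: \<eta>_def m_def)
qed

text \<open>
  The \<open>\<ell>\<^sup>1\<close> norm is a maximum over \<open>2\<^sup>N\<close> sign patterns, so a union bound costs only \<open>2\<^sup>N\<close>.
\<close>

lemma class_residual_l1_tail:
  fixes p q :: real
  assumes bal: "balanced_classes N C1 C2" and pq: "0 \<le> q" "q < p" "p \<le> 1"
    and large: "1 \<le> real N * (p + q)"
  shows "measure_pmf.prob (edge_indicators N C1 C2 p q)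
           {e. (\<Sum>v<N. \<bar>class_residual N C1 ((p - q) / (p + q)) (adjacency_matrix N e) v\<bar>)
                 \<ge> 12 * real N * sqrt (real N * (p + q))}
         \<le> exp (- real N)"
proof -
  define E where "E = edge_indicators N C1 C2 p q"
  define Z where "Z = (\<lambda>e. class_residual N C1 ((p - q) / (p + q)) (adjacency_matrix N e))"
  define R where "R = 12 * real N * sqrt (real N * (p + q))"
  define t :: "nat set \<Rightarrow> nat \<Rightarrow> real" where "t = (\<lambda>T v. if v \<in> T then - 1 else 1)"
  have "{e. (\<Sum>v<N. \<bar>Z e v\<bar>) \<ge> R} \<subseteq> (\<Union>T\<in>Pow {..<N}. {e. (\<Sum>v<N. t T v * Z e v) \<ge> R})"
  proof
    fix e assume e: "e \<in> {e. (\<Sum>v<N. \<bar>Z e v\<bar>) \<ge> R}"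
    have "(\<Sum>v<N. t {v. v < N \<and> Z e v < 0} v * Z e v) = (\<Sum>v<N. \<bar>Z e v\<bar>)"
      by (intro sum.cong) (auto simp: t_def)
    then show "e \<in> (\<Union>T\<in>Pow {..<N}. {e. (\<Sum>v<N. t T v * Z e v) \<ge> R})"
      using e by (intro UN_I[of "{v. v < N \<and> Z e v < 0}"]) auto
  qed
  then have "measure_pmf.prob E {e. (\<Sum>v<N. \<bar>Z e v\<bar>) \<ge> R}
      \<le> measure_pmf.prob E (\<Union>T\<in>Pow {..<N}. {e. (\<Sum>v<N. t T v * Z e v) \<ge> R})"
    by (intro measure_pmf.finite_measure_mono) auto
  also have "\<dots> \<le> (\<Sum>T\<in>Pow {..<N}. measure_pmf.prob E {e. (\<Sum>v<N. t T v * Z e v) \<ge> R})"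
    by (rule measure_UNION_le) auto
  also have "\<dots> \<le> (\<Sum>T\<in>Pow {..<N}. exp (- (11 / 4 * real N)))"
    unfolding E_def Z_def R_def
    by (intro sum_mono class_residual_signed_tail assms) (auto simp: t_def)
  also have "\<dots> = 2 ^ N * exp (- (11 / 4 * real N))"
    by (simp add: card_Pow)
  \<comment> \<open>The crude bound \<open>2 \<le> exp 1\<close> absorbs the number of patterns and
    leaves the rate \<open>11/4 - 1 = 7/4\<close>.\<close>
  also have "\<dots> \<le> exp 1 ^ N * exp (- (11 / 4 * real N))"
  proof -
    have "(2::real) \<le> exp 1"
      using exp_ge_add_one_self[of 1] by simp
    then show ?thesis
      by (intro mult_right_mono power_mono) auto
  qed
  also have "\<dots> = exp (- (7 / 4 * real N))"
    by (simp flip: exp_of_nat_mult exp_add)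
  also have "\<dots> \<le> exp (- real N)"
    by simp
  finally show ?thesis
    by (simp add: E_def Z_def R_def)
qed

section \<open>Combination of the bounds and the asymptotic regime\<close>

text \<open>The bad events are a low degree at one of the \<open>N\<close> nodes and a large
  residual norm. Outside them the deterministic bound applies with \<open>\<delta> = m / 4\<close>
  and residual norm at most \<open>12 * N * sqrt m\<close>, where \<open>m = N * (p + q)\<close>;
  this gives \<open>48 = 12 * 4\<close> and the rate \<open>sqrt m / m = 1 / sqrt m\<close>.\<close>

lemma sbm_ppnp_diff_prob:
  fixes mu1 mu2 \<alpha> p q :: real
  assumes bal: "balanced_classes N C1 C2" and N: "N > 0" and mu: "mu1 \<le> mu2"
    and \<alpha>: "0 < \<alpha>" "\<alpha> < 1" and pq: "0 < q" "q < p" "p \<le> 1"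
    and large: "1 \<le> real N * (p + q)"
  shows "measure_pmf.prob (sbm_pmf N C1 C2 p q)
           {A. (\<forall>v<N. degree_vec A $ v > 0) \<and>
               \<bar>mu_ppnp \<alpha> N C1 mu1 mu2 A C2 - mu_ppnp \<alpha> N C1 mu1 mu2 A C1
                  - (p + q) / (p + (2 - \<alpha>) / \<alpha> * q) * (mu2 - mu1)\<bar>
                \<le> 48 * ((1 - \<alpha>) / \<alpha> * (mu2 - mu1)) / sqrt (real N * (p + q))}
         \<ge> 1 - (real N * exp (- (real N * (p + q) / 64)) + exp (- real N))"
    (is "measure_pmf.prob _ {A. ?good A} \<ge> _")
proof -
  define E where "E = edge_indicators N C1 C2 p q"
  define m where "m = real N * (p + q)"
  define low where "low = (\<lambda>v. {e. degree_vec (adjacency_matrix N e) $ v \<le> m / 4})"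
  define R where "R = {e. (\<Sum>v<N. \<bar>class_residual N C1 ((p - q) / (p + q)) (adjacency_matrix N e) v\<bar>)
                 \<ge> 12 * real N * sqrt m}"
  have m: "m > 0"
    using large by (simp add: m_def)
  have good: "?good (adjacency_matrix N e)" if e: "e \<notin> (\<Union>v<N. low v) \<union> R" for e
  proof -
    let ?A = "adjacency_matrix N e"
    have deg: "degree_vec ?A $ v \<ge> m / 4" if "v < N" for v
      using e that by (force simp: low_def)
    have "\<bar>mu_ppnp \<alpha> N C1 mu1 mu2 ?A C2 - mu_ppnp \<alpha> N C1 mu1 mu2 ?A C1
                  - (p + q) / (p + (2 - \<alpha>) / \<alpha> * q) * (mu2 - mu1)\<bar>
       \<le> (1 - \<alpha>) / \<alpha> * (mu2 - mu1) *
            (\<Sum>v<N. \<bar>class_residual N C1 ((p - q) / (p + q)) ?A v\<bar>) / (N * (m / 4))"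
      unfolding class_residual_def
      by (rule mu_ppnp_diff_bound)
        (use deg m \<alpha> pq mu bal N in \<open>auto simp: min.commute max.commute\<close>)
    also have "\<dots> \<le> (1 - \<alpha>) / \<alpha> * (mu2 - mu1) * (12 * real N * sqrt m) / (N * (m / 4))"
      using e m \<alpha> mu by (intro divide_right_mono mult_left_mono) (auto simp: R_def)
    also have "\<dots> = 48 * ((1 - \<alpha>) / \<alpha> * (mu2 - mu1)) * (sqrt m / m)"
      using N by simp
    also have "sqrt m / m = 1 / sqrt m"
      using m by (simp add: real_div_sqrt field_simps)
    finally show ?thesis
      using deg m by (fastforce simp: m_def)
  qed
  have "measure_pmf.prob E ((\<Union>v<N. low v) \<union> R) \<le> measure_pmf.prob E (\<Union>v<N. low v) + measure_pmf.prob E R"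
    by (rule measure_Un_le) auto
  also have "measure_pmf.prob E (\<Union>v<N. low v) \<le> (\<Sum>v<N. measure_pmf.prob E (low v))"
    by (rule measure_UNION_le) auto
  also have "\<dots> \<le> (\<Sum>v<N. exp (- (m / 64)))"
    unfolding E_def low_def m_def using pq by (intro sum_mono degree_tail bal) auto
  also have "measure_pmf.prob E R \<le> exp (- real N)"
    unfolding E_def R_def m_def using pq by (intro class_residual_l1_tail bal large) auto
  finally have "measure_pmf.prob E ((\<Union>v<N. low v) \<union> R) \<le> real N * exp (- (m / 64)) + exp (- real N)"
    by simp
  moreover have "measure_pmf.prob E (- ((\<Union>v<N. low v) \<union> R)) = 1 - measure_pmf.prob E ((\<Union>v<N. low v) \<union> R)"
    using measure_pmf.prob_compl[of "(\<Union>v<N. low v) \<union> R" E] by (simp add: Compl_eq_Diff_UNIV)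
  moreover have "measure_pmf.prob E (- ((\<Union>v<N. low v) \<union> R))
      \<le> measure_pmf.prob E (adjacency_matrix N -` {A. ?good A})"
    using good by (intro measure_pmf.finite_measure_mono) auto
  ultimately show ?thesis
    by (simp add: sbm_pmf_edge_indicators E_def m_def)
qed

text \<open>An event about the graph alone is a rectangle whose second side is the whole feature
  space, and that side has probability 1.\<close>

lemma prob_csbm_graph:
  assumes "\<sigma> > 0"
  shows "\<P>(G in csbm N C1 C2 p q mu1 mu2 \<sigma>. Q (fst G)) = measure_pmf.prob (sbm_pmf N C1 C2 p q) {A. Q A}"
proof -
  let ?X = "\<Pi>\<^sub>M v\<in>{..<N}. density lborel (\<lambda>x. ennreal (normal_density (class_mean C1 mu1 mu2 v) \<sigma> x))"
  interpret X: prob_space ?X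
    by (intro prob_space_PiM prob_space_normal_density assms)
  have "{G \<in> space (csbm N C1 C2 p q mu1 mu2 \<sigma>). Q (fst G)} = {A. Q A} \<times> space ?X"
    by (auto simp: csbm_def space_pair_measure)
  then show ?thesis
    by (simp add: csbm_def measure_def X.emeasure_pair_measure_Times X.emeasure_space_1)
qed

theorem proposition2:
  fixes mu1 mu2 \<alpha> r :: real and K :: nat
  assumes "mu1 < mu2" and "0 < \<alpha>" and "\<alpha> < 1" and "r > 0"
  shows "\<exists>C::real. \<forall>(\<sigma>::real) (p :: nat \<Rightarrow> real) (q :: nat \<Rightarrow> real)
            (C1 :: nat \<Rightarrow> nat set) (C2 :: nat \<Rightarrow> nat set).
     \<sigma> > 0 \<longrightarrow>
     (\<forall>N. 0 < q N \<and> q N < p N \<and> p N \<le> 1) \<longrightarrow>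
     p \<in> \<omega>(\<lambda>N. ln (real N) / real N) \<longrightarrow>
     q \<in> \<omega>(\<lambda>N. ln (real N) / real N) \<longrightarrow>
     (\<forall>N. even N \<longrightarrow> balanced_classes N (C1 N) (C2 N)) \<longrightarrow>
     (\<exists>(B::real) (N0::nat). \<forall>N\<ge>N0. even N \<longrightarrow>
        \<P>(G in csbm N (C1 N) (C2 N) (p N) (q N) mu1 mu2 \<sigma>.
            (\<forall>v<N. degree_vec (fst G) $ v > 0) \<and>
            (\<exists>\<epsilon>::real.
               mu_ppnp \<alpha> N (C1 N) mu1 mu2 (fst G) (C2 N)
                 - mu_ppnp \<alpha> N (C1 N) mu1 mu2 (fst G) (C1 N)
               = (p N + q N) / (p N + (2 - \<alpha>) / \<alpha> * q N) * (mu2 - mu1) + \<epsilon> \<and>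
               \<bar>\<epsilon>\<bar> \<le> C / sqrt (real N * (p N + q N)) + (1 - \<alpha>) ^ (K + 1)))
        \<ge> 1 - B / real N powr r)"
proof -
  define C where "C = 48 * ((1 - \<alpha>) / \<alpha> * (mu2 - mu1))"
  show ?thesis
  proof (rule exI[of _ C], intro allI impI)
    fix \<sigma> :: real and p q :: "nat \<Rightarrow> real" and C1 C2 :: "nat \<Rightarrow> nat set"
    assume \<sigma>: "\<sigma> > 0" and pq: "\<forall>N. 0 < q N \<and> q N < p N \<and> p N \<le> 1"
      and p: "p \<in> \<omega>(\<lambda>N. ln (real N) / real N)"
      and bal: "\<forall>N. even N \<longrightarrow> balanced_classes N (C1 N) (C2 N)"
    \<comment> \<open>Once \<open>N * p\<close> is at least \<open>c * ln N\<close>, the low-degree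
      term \<open>N * exp (- (N * (p + q) / 64))\<close> is at most
      \<open>N * N powr (- (r + 1)) = N powr (- r)\<close>.\<close>
    define c where "c = 64 * (r + 1)"
    have c: "c > 1"
      using \<open>r > 0\<close> by (simp add: c_def)
    have "eventually (\<lambda>N. norm (p N) \<ge> c * norm (ln (real N) / real N)) at_top"
      using landau_omega.smallD[OF p, of c] c by simp
    moreover have "eventually (\<lambda>N. exp (- real N) \<le> 1 / real N powr r) at_top"
      using \<open>r > 0\<close> by real_asymp
    \<comment> \<open>Together with \<open>c > 1\<close> this yields
      \<open>N * (p + q) \<ge> 1\<close>, the size condition of the residual bound.\<close>
    moreover have "eventually (\<lambda>N. ln (real N) \<ge> 1) at_top"
      by real_asymp
    ultimately have "eventually (\<lambda>N. norm (p N) \<ge> c * norm (ln (real N) / real N)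
        \<and> exp (- real N) \<le> 1 / real N powr r \<and> ln (real N) \<ge> 1 \<and> N \<ge> 1) at_top"
      using eventually_ge_at_top[of 1] by eventually_elim auto
    then obtain N0 where N0: "\<And>N. N \<ge> N0 \<Longrightarrow> norm (p N) \<ge> c * norm (ln (real N) / real N)
        \<and> exp (- real N) \<le> 1 / real N powr r \<and> ln (real N) \<ge> 1 \<and> N \<ge> 1"
      unfolding eventually_at_top_linorder by blast
    show "\<exists>(B::real) (N0::nat). \<forall>N\<ge>N0. even N \<longrightarrow>
        \<P>(G in csbm N (C1 N) (C2 N) (p N) (q N) mu1 mu2 \<sigma>.
            (\<forall>v<N. degree_vec (fst G) $ v > 0) \<and>
            (\<exists>\<epsilon>::real.
               mu_ppnp \<alpha> N (C1 N) mu1 mu2 (fst G) (C2 N)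
                 - mu_ppnp \<alpha> N (C1 N) mu1 mu2 (fst G) (C1 N)
               = (p N + q N) / (p N + (2 - \<alpha>) / \<alpha> * q N) * (mu2 - mu1) + \<epsilon> \<and>
               \<bar>\<epsilon>\<bar> \<le> C / sqrt (real N * (p N + q N)) + (1 - \<alpha>) ^ (K + 1)))
        \<ge> 1 - B / real N powr r"
    \<comment> \<open>The value 2 counts the two failure terms, low degrees and large residual, each
      at most \<open>1 / N powr r\<close>.\<close>
    proof (rule exI[of _ 2], rule exI[of _ N0], intro allI impI)
      fix N assume N: "N \<ge> N0" and "even N"
      note * = N0[OF N]
      have pqN: "0 < q N" "q N < p N" "p N \<le> 1"
        using pq by auto
      have "ln (real N) > 0"
        using * by linarith
      then have "c * (ln (real N) / real N) \<le> p N"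
        using * pqN by simp
      then have "c * ln (real N) \<le> real N * p N"
        using * by (simp add: field_simps)
      also have "\<dots> \<le> real N * (p N + q N)"
        using pqN by (intro mult_left_mono) auto
      finally have deg: "c * ln (real N) \<le> real N * (p N + q N)" .
      have "1 * 1 \<le> c * ln (real N)"
        using * c by (intro mult_mono) auto
      then have large: "1 \<le> real N * (p N + q N)"
        using deg by simp
      have "exp (- (real N * (p N + q N) / 64)) \<le> exp (- (r + 1) * ln (real N))"
        using deg by (simp add: c_def algebra_simps)
      also have "\<dots> = real N powr (- (r + 1))"
        using * by (simp add: powr_def)
      also have "\<dots> = real N powr (- r) / real N"
        using * powr_add[of "real N" "- r" "- 1"] by (simp add: powr_minus_divide)
      finally have "real N * exp (- (real N * (p N + q N) / 64)) \<le> 1 / real N powr r"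
        using * by (simp add: powr_minus_divide field_simps)
      moreover have "exp (- real N) \<le> 1 / real N powr r"
        using * by blast
      ultimately have "1 - 2 / real N powr r \<le> 1 - (real N * exp (- (real N * (p N + q N) / 64)) + exp (- real N))"
        by linarith
      also have "\<dots> \<le> measure_pmf.prob (sbm_pmf N (C1 N) (C2 N) (p N) (q N))
           {A. (\<forall>v<N. degree_vec A $ v > 0) \<and>
               \<bar>mu_ppnp \<alpha> N (C1 N) mu1 mu2 A (C2 N) - mu_ppnp \<alpha> N (C1 N) mu1 mu2 A (C1 N)
                  - (p N + q N) / (p N + (2 - \<alpha>) / \<alpha> * q N) * (mu2 - mu1)\<bar>
                \<le> C / sqrt (real N * (p N + q N))}"
        unfolding C_def
        by (rule sbm_ppnp_diff_prob) (use bal \<open>even N\<close> * assms pqN large in auto)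
      also have "\<dots> \<le> measure_pmf.prob (sbm_pmf N (C1 N) (C2 N) (p N) (q N))
           {A. (\<forall>v<N. degree_vec A $ v > 0) \<and>
            (\<exists>\<epsilon>::real.
               mu_ppnp \<alpha> N (C1 N) mu1 mu2 A (C2 N)
                 - mu_ppnp \<alpha> N (C1 N) mu1 mu2 A (C1 N)
               = (p N + q N) / (p N + (2 - \<alpha>) / \<alpha> * q N) * (mu2 - mu1) + \<epsilon> \<and>
               \<bar>\<epsilon>\<bar> \<le> C / sqrt (real N * (p N + q N)) + (1 - \<alpha>) ^ (K + 1))}"
      proof (intro measure_pmf.finite_measure_mono Collect_mono impI, elim conjE, intro conjI)
        fix A
        let ?\<epsilon> = "mu_ppnp \<alpha> N (C1 N) mu1 mu2 A (C2 N) - mu_ppnp \<alpha> N (C1 N) mu1 mu2 A (C1 N)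
                  - (p N + q N) / (p N + (2 - \<alpha>) / \<alpha> * q N) * (mu2 - mu1)"
        assume "\<bar>?\<epsilon>\<bar> \<le> C / sqrt (real N * (p N + q N))"
        moreover have "(1 - \<alpha>) ^ (K + 1) \<ge> 0"
          using assms by simp
        ultimately show "\<exists>\<epsilon>::real.
               mu_ppnp \<alpha> N (C1 N) mu1 mu2 A (C2 N)
                 - mu_ppnp \<alpha> N (C1 N) mu1 mu2 A (C1 N)
               = (p N + q N) / (p N + (2 - \<alpha>) / \<alpha> * q N) * (mu2 - mu1) + \<epsilon> \<and>
               \<bar>\<epsilon>\<bar> \<le> C / sqrt (real N * (p N + q N)) + (1 - \<alpha>) ^ (K + 1)"
          by (intro exI[of _ ?\<epsilon>]) linarith
      qed auto
      finally show "\<P>(G in csbm N (C1 N) (C2 N) (p N) (q N) mu1 mu2 \<sigma>.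
            (\<forall>v<N. degree_vec (fst G) $ v > 0) \<and>
            (\<exists>\<epsilon>::real.
               mu_ppnp \<alpha> N (C1 N) mu1 mu2 (fst G) (C2 N)
                 - mu_ppnp \<alpha> N (C1 N) mu1 mu2 (fst G) (C1 N)
               = (p N + q N) / (p N + (2 - \<alpha>) / \<alpha> * q N) * (mu2 - mu1) + \<epsilon> \<and>
               \<bar>\<epsilon>\<bar> \<le> C / sqrt (real N * (p N + q N)) + (1 - \<alpha>) ^ (K + 1)))
        \<ge> 1 - 2 / real N powr r"
        by (subst prob_csbm_graph[OF \<sigma>])
    qed
  qed
qed

end
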